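(* Let $A$ be a real $m\times n$ matrix having the SSVP and let $P$ be a superpattern of the pattern of $A$. Then there exists a real $m\times n$ matrix with pattern $P$ and with list of singular values $\Sigma(A)$.
   Context: All matrices are real. A pattern is a matrix with entries in $\{0,1\}$. The pattern of a matrix $A$ is the $(0,1)$-matrix obtained from $A$ by replacing each nonzero entry by $1$. A superpattern of a pattern $P_0$ is a pattern obtained from $P_0$ by changing some of its zeros to ones. $\Sigma(A)$ denotes the list (with multiplicity) of singular values of the $m\times n$ matrix $A$; for $m\le n$ these are the $m$ nonnegative square roots of the eigenvalues of $AA^\top$, and for $m>n$ the same formula may be used. $A\circ X$ is the entrywise (Schur) product. An $m\times n$ matrix $A$ has the Strong Singular Value Property (SSVP) if the zero matrix is the only real $m\times n$ matrix $X$ such that $XA^\top$ is symmetric, $A^\top X$ is symmetric, and $A\circ X=O$. *)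

theory Defs
  imports "HOL-Analysis.Analysis" "HOL-Computational_Algebra.Polynomial" "HOL-Library.Multiset"
begin

text \<open>An \<open>m \<times> n\<close> real matrix has type \<^typ>\<open>real^'n^'m\<close> with \<open>m = CARD('m)\<close> rows and
  \<open>n = CARD('n)\<close> columns.\<close>

definition is_pattern :: "real^'n^'m \<Rightarrow> bool" where
  "is_pattern P \<longleftrightarrow> (\<forall>i j. P $ i $ j \<in> {0, 1})"

definition pattern_of :: "real^'n^'m \<Rightarrow> real^'n^'m" where
  "pattern_of A = (\<chi> i j. if A $ i $ j = 0 then 0 else 1)"

text \<open>The set of changed zeros may be empty: every pattern is a superpattern of itself.\<close>

definition superpattern :: "real^'n^'m \<Rightarrow> real^'n^'m \<Rightarrow> bool" where
  "superpattern P P\<^sub>0 \<longleftrightarrow>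
     is_pattern P \<and> is_pattern P\<^sub>0 \<and> (\<forall>i j. P\<^sub>0 $ i $ j = 1 \<longrightarrow> P $ i $ j = 1)"

definition schur_product :: "real^'n^'m \<Rightarrow> real^'n^'m \<Rightarrow> real^'n^'m" where
  "schur_product A X = (\<chi> i j. A $ i $ j * X $ i $ j)"

definition symmetric_matrix :: "real^'n^'n \<Rightarrow> bool" where
  "symmetric_matrix M \<longleftrightarrow> transpose M = M"

definition SSVP :: "real^'n^'m \<Rightarrow> bool" where
  "SSVP A \<longleftrightarrow>
     (\<forall>X :: real^'n^'m.
        symmetric_matrix (X ** transpose A) \<and> symmetric_matrix (transpose A ** X) \<and>
        schur_product A X = 0 \<longrightarrow> X = 0)"

text \<open>The characteristic polynomial \<open>det (t I - M)\<close>, as a determinant over the ring of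
  polynomials; \<open>[:0, 1:]\<close> is the indeterminate \<open>t\<close>.\<close>

definition charpoly :: "real^'n^'n \<Rightarrow> real poly" where
  "charpoly M = det (mat [:0, 1:] - map_matrix (\<lambda>c. [:c:]) M)"

text \<open>Only real eigenvalues are collected, with algebraic multiplicity. For a symmetric matrix,
  the only case used below, these are all of the eigenvalues.\<close>

definition eigenvalues :: "real^'n^'n \<Rightarrow> real multiset" where
  "eigenvalues M = proots (charpoly M)"

text \<open>The list of singular values, with multiplicity and up to order. As \<open>A A\<^sup>T\<close> is \<open>m \<times> m\<close>,
  it has \<open>m\<close> elements, also when \<open>m > n\<close>.\<close>

definition singular_values :: "real^'n^'m \<Rightarrow> real multiset" where
  "singular_values A = image_mset sqrt (eigenvalues (A ** transpose A))"

end

theory Submission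
  imports Defs
begin

text \<open>
  Every matrix \<open>U A V\<close> with \<open>U\<close>, \<open>V\<close> orthogonal has the singular values of \<open>A\<close>. With \<open>U\<close>, \<open>V\<close>
  parametrized by the Cayley transform of the skew-symmetric matrices \<open>K - K\<^sup>T\<close>, \<open>L - L\<^sup>T\<close>,
  consider the map \<open>(K, L, C) \<mapsto> U A V + A \<circ> C\<close>. The orthogonal complement of the range of its
  derivative at \<open>0\<close> consists of the \<open>X\<close> for which \<open>X A\<^sup>T\<close> and \<open>A\<^sup>T X\<close> are symmetric and
  \<open>A \<circ> X = 0\<close>, so the SSVP says that this derivative is surjective. Hence the map is open at \<open>0\<close>:
  for small \<open>\<epsilon>\<close>, the matrix obtained from \<open>A\<close> by putting \<open>\<epsilon>\<close> at the changed zeros is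
  attained, with \<open>U A V\<close> close to \<open>A\<close>. As \<open>A \<circ> C\<close> does not affect the zero positions of \<open>A\<close>,
  the matrix \<open>U A V\<close> has the required pattern.
\<close>

section \<open>Invariance of the singular values\<close>

lemma map_matrix_const_poly_mult:
  fixes A :: "real^'n^'m" and B :: "real^'k^'n"
  shows "map_matrix (\<lambda>c. [:c:]) (A ** B) = map_matrix (\<lambda>c. [:c:]) A ** map_matrix (\<lambda>c. [:c:]) B"
proof -
  have "(\<Sum>x\<in>S. [:f x:]) = [:sum f S:]" for f :: "'n \<Rightarrow> real" and S
    by (induction S rule: infinite_finite_induct) simp_all
  then show ?thesis
    by (simp add: vec_eq_iff matrix_matrix_mult_def mult.commute)
qed

lemma matrix_diff_ldistrib: "A ** (B - C) = A ** B - A ** (C :: 'a::ring_1^'n^'k)"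
  by (simp add: vec_eq_iff matrix_matrix_mult_def right_diff_distrib sum_subtractf)

lemma matrix_diff_rdistrib: "(A - B) ** C = A ** C - B ** (C :: 'a::ring_1^'n^'k)"
  by (simp add: vec_eq_iff matrix_matrix_mult_def left_diff_distrib sum_subtractf)

text \<open>The scalar matrix \<open>t I\<close> commutes with every matrix, so
  \<open>t I - U M U\<^sup>T\<close> factors as \<open>U (t I - M) U\<^sup>T\<close> over the
  polynomials, and the determinants of the outer factors multiply to 1.\<close>

lemma charpoly_orthogonal_conj:
  fixes M U :: "real^'n^'n"
  assumes "orthogonal_matrix U"
  shows "charpoly (U ** M ** transpose U) = charpoly M"
proof -
  let ?c = "map_matrix (\<lambda>c::real. [:c:]) :: real^'n^'n \<Rightarrow> real poly^'n^'n"
  let ?X = "mat [:0, 1:] :: real poly^'n^'n"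
  have one: "?c U ** ?c (transpose U) = mat 1"
    using assms
    by (simp add: orthogonal_matrix_def flip: map_matrix_const_poly_mult)
       (simp add: vec_eq_iff mat_def one_pCons)
  have comm: "?X ** N = N ** ?X" for N
    by (simp add: vec_eq_iff matrix_matrix_mult_def mat_def if_distrib if_distribR mult.commute
        cong: if_cong)
  have "?X - ?c (U ** M ** transpose U) = ?c U ** (?X - ?c M) ** ?c (transpose U)"
    by (simp add: matrix_diff_ldistrib matrix_diff_rdistrib map_matrix_const_poly_mult
        flip: comm[of "?c U"])
       (simp add: one flip: matrix_mul_assoc)
  then show ?thesis
    unfolding charpoly_def using one
    by (metis (no_types, lifting) det_I det_mul mult.commute mult.left_commute mult_1)
qed

lemma singular_values_orthogonal:
  fixes A :: "real^'n^'m"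
  assumes "orthogonal_matrix U" "orthogonal_matrix V"
  shows "singular_values (U ** A ** V) = singular_values A"
proof -
  have "(U ** A ** V) ** transpose (U ** A ** V) = U ** (A ** (V ** transpose V) ** transpose A) ** transpose U"
    by (simp add: matrix_transpose_mul matrix_mul_assoc)
  also have "\<dots> = U ** (A ** transpose A) ** transpose U"
    using assms by (simp add: orthogonal_matrix_def)
  finally show ?thesis
    using assms by (simp add: singular_values_def eigenvalues_def charpoly_orthogonal_conj)
qed

section \<open>The Cayley transform\<close>

lemma matrix_add_rdistrib: "(A + B) ** C = A ** C + B ** (C :: 'a::semiring_1^'n^'k)"
  by (simp add: vec_eq_iff matrix_matrix_mult_def distrib_right sum.distrib)

lemma transpose_zero: "transpose 0 = 0"
  by (simp add: vec_eq_iff transpose_def)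

lemma transpose_diff: "transpose (A - B) = transpose A - transpose (B :: 'a::minus^'n^'m)"
  by (simp add: vec_eq_iff transpose_def)

lemma bounded_bilinear_matrix_matrix_mult:
  "bounded_bilinear ((**) :: real^'n^'m \<Rightarrow> real^'k^'n \<Rightarrow> real^'k^'m)"
proof -
  have "bilinear ((**) :: real^'n^'m \<Rightarrow> real^'k^'n \<Rightarrow> real^'k^'m)"
    unfolding bilinear_def
    by (auto intro!: linearI simp: vec_eq_iff matrix_matrix_mult_def algebra_simps sum.distrib
        sum_distrib_left)
  then show ?thesis
    by (simp add: bilinear_conv_bounded_bilinear)
qed

section \<open>The resolvent of a skew-symmetric matrix\<close>

text \<open>The parameter is an arbitrary \<open>K\<close>, entering through its skew-symmetric part
  \<open>S = K - K\<^sup>T\<close>, so that the domain is a whole Euclidean space.\<close>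

definition resolvent :: "real^'n^'n \<Rightarrow> real^'n^'n" where
  "resolvent K = matrix_inv (mat 1 - (K - transpose K))"

text \<open>Skew-symmetry of \<open>S\<close> gives \<open>x \<bullet> S x = 0\<close>, hence
  \<open>x \<bullet> x = x \<bullet> (I - S) x\<close>, and Cauchy-Schwarz applies. This yields both
  the invertibility of \<open>I - S\<close> and a uniform bound on its inverse.\<close>

lemma norm_le_one_minus_skew:
  fixes K :: "real^'n^'n"
  shows "norm x \<le> norm ((mat 1 - (K - transpose K)) *v x)"
proof -
  have "x \<bullet> (transpose K *v x) = x \<bullet> (K *v x)"
    by (metis dot_lmul_matrix inner_commute transpose_matrix_vector)
  then have "x \<bullet> ((K - transpose K) *v x) = 0"
    by (simp add: matrix_vector_mult_diff_rdistrib inner_diff_right)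
  then have "norm x * norm x = x \<bullet> ((mat 1 - (K - transpose K)) *v x)"
    by (simp add: matrix_vector_mult_diff_rdistrib inner_diff_right flip: power2_norm_eq_inner power2_eq_square)
  also have "\<dots> \<le> norm x * norm ((mat 1 - (K - transpose K)) *v x)"
    by (rule norm_cauchy_schwarz)
  finally show ?thesis
    by (cases "x = 0") auto
qed

lemma
  fixes K :: "real^'n^'n"
  shows resolvent_right: "(mat 1 - (K - transpose K)) ** resolvent K = mat 1"
    and resolvent_left: "resolvent K ** (mat 1 - (K - transpose K)) = mat 1"
proof -
  have "\<exists>B. B ** (mat 1 - (K - transpose K)) = mat 1"
    unfolding matrix_left_invertible_ker
    by (metis norm_le_one_minus_skew norm_le_zero_iff norm_zero)
  then have "invertible (mat 1 - (K - transpose K))"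
    by (simp add: invertible_left_inverse)
  then have "(mat 1 - (K - transpose K)) ** resolvent K = mat 1
      \<and> resolvent K ** (mat 1 - (K - transpose K)) = mat 1"
    unfolding invertible_def resolvent_def matrix_inv_def by (rule someI_ex)
  then show "(mat 1 - (K - transpose K)) ** resolvent K = mat 1"
    "resolvent K ** (mat 1 - (K - transpose K)) = mat 1"
    by auto
qed

lemma bounded_resolvent: "bounded (range (resolvent :: real^'n^'n \<Rightarrow> _))"
proof -
  have "norm (resolvent K) \<le> (\<Sum>i\<in>(UNIV::'n set). \<Sum>j\<in>(UNIV::'n set). 1)" for K :: "real^'n^'n"
  proof -
    have "\<bar>resolvent K $ i $ j\<bar> \<le> 1" for i j
    proof -
      \<comment> \<open>Column \<open>j\<close> of the inverse is mapped by \<open>I - S\<close> to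
        the unit vector \<open>axis j 1\<close>, so its norm is at most 1.\<close>
      have "\<bar>resolvent K $ i $ j\<bar> = \<bar>(resolvent K *v axis j 1) $ i\<bar>"
        by (simp add: matrix_vector_mul_component inner_axis)
      also have "\<dots> \<le> norm (resolvent K *v axis j 1)"
        by (rule component_le_norm_cart)
      also have "\<dots> \<le> norm ((mat 1 - (K - transpose K)) *v (resolvent K *v axis j 1))"
        by (rule norm_le_one_minus_skew)
      finally show ?thesis
        by (simp add: matrix_vector_mul_assoc resolvent_right)
    qed
    then have "(\<Sum>j\<in>UNIV. \<bar>resolvent K $ i $ j\<bar>) \<le> (\<Sum>j\<in>(UNIV::'n set). 1)" for i
      by (intro sum_mono)
    then have "norm (resolvent K $ i) \<le> (\<Sum>j\<in>(UNIV::'n set). 1)" for i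
      using norm_le_l1_cart order_trans by blast
    then have "(\<Sum>i\<in>UNIV. norm (resolvent K $ i)) \<le> (\<Sum>i\<in>(UNIV::'n set). \<Sum>j\<in>(UNIV::'n set). 1)"
      by (rule sum_mono)
    moreover have "norm (resolvent K) \<le> (\<Sum>i\<in>UNIV. norm (resolvent K $ i))"
      unfolding norm_vec_def[of "resolvent K"] by (rule L2_set_le_sum) simp
    ultimately show ?thesis
      by linarith
  qed
  then show ?thesis
    by (auto simp: bounded_iff)
qed

text \<open>The resolvent identity: the inverses of \<open>M\<close> and \<open>N\<close> differ by
  \<open>M\<^sup>-\<^sup>1 (N - M) N\<^sup>-\<^sup>1\<close>. Continuity and the derivative at 0
  both follow from it.\<close>

lemma resolvent_diff:
  "resolvent K - resolvent L
     = resolvent K ** ((K - L) - transpose (K - L)) ** resolvent L"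
proof -
  have "resolvent K - resolvent L = resolvent K ** ((mat 1 - (L - transpose L)) ** resolvent L)
      - (resolvent K ** (mat 1 - (K - transpose K))) ** resolvent L"
    by (simp add: resolvent_left resolvent_right)
  also have "\<dots> = resolvent K ** ((mat 1 - (L - transpose L)) - (mat 1 - (K - transpose K)))
      ** resolvent L"
    by (simp only: matrix_mul_assoc matrix_diff_ldistrib matrix_diff_rdistrib)
  also have "(mat 1 - (L - transpose L)) - (mat 1 - (K - transpose K))
      = (K - L) - transpose (K - L)"
    by (simp add: transpose_diff)
  finally show ?thesis .
qed

lemma linear_skew_part: "linear (\<lambda>K :: real^'n^'n. K - transpose K)"
  by (rule linearI) (simp_all add: vec_eq_iff transpose_def algebra_simps)

lemma bounded_linear_skew_part: "bounded_linear (\<lambda>K :: real^'n^'n. K - transpose K)"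
  using linear_skew_part linear_conv_bounded_linear by blast

lemma resolvent_0: "resolvent 0 = mat 1"
  using resolvent_left[of 0] by (simp add: transpose_zero)

lemma continuous_on_resolvent: "continuous_on UNIV (resolvent :: real^'n^'n \<Rightarrow> _)"
proof -
  obtain B where B: "\<And>K :: real^'n^'n. norm (resolvent K) \<le> B"
    using bounded_resolvent by (auto simp: bounded_iff)
  have bdd: "Bfun resolvent F" for F :: "(real^'n^'n) filter"
    using B by (intro BfunI[of _ B]) simp
  have "(resolvent \<longlongrightarrow> resolvent L) (at L)" for L :: "real^'n^'n"
  proof -
    have "((\<lambda>K. (K - L) - transpose (K - L)) \<longlongrightarrow> (L - L) - transpose (L - L)) (at L)"
      by (intro bounded_linear.tendsto[OF bounded_linear_skew_part] tendsto_intros)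
    then have "Zfun (\<lambda>K. (K - L) - transpose (K - L)) (at L)"
      by (simp add: tendsto_Zfun_iff transpose_zero)
    \<comment> \<open>In the resolvent identity the middle factor tends to 0, the left one stays
      bounded and the right one is constant.\<close>
    then have "Zfun (\<lambda>K. resolvent K ** ((K - L) - transpose (K - L)) ** resolvent L) (at L)"
      by (rule bounded_bilinear.Zfun_prod_Bfun[OF bounded_bilinear_matrix_matrix_mult
            bounded_bilinear.Bfun_prod_Zfun[OF bounded_bilinear_matrix_matrix_mult bdd]])
         (auto intro: BfunI)
    then show ?thesis
      by (simp add: tendsto_Zfun_iff flip: resolvent_diff)
  qed
  then show ?thesis
    by (simp add: continuous_on_def)
qed

lemma has_derivative_resolvent_0:
  "((resolvent :: real^'n^'n \<Rightarrow> _) has_derivative (\<lambda>K. K - transpose K)) (at 0)"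
proof -
  obtain C where C: "C \<ge> 0" "\<And>(M :: real^'n^'n) (N :: real^'n^'n). norm (M ** N) \<le> norm M * norm N * C"
    using bounded_bilinear.nonneg_bounded[OF bounded_bilinear_matrix_matrix_mult] by metis
  obtain D where D: "\<And>K :: real^'n^'n. norm (K - transpose K) \<le> norm K * D"
    using bounded_linear.bounded[OF bounded_linear_skew_part] by metis
  have "norm (resolvent (0 + K) - resolvent 0 - (K - transpose K)) / norm K
      \<le> norm (resolvent K - resolvent 0) * (D * C)" for K :: "real^'n^'n"
  proof -
    \<comment> \<open>The resolvent identity at \<open>L = 0\<close> makes the remainder a product
      of two factors: the first tends to 0 by continuity, the second is linear in
      \<open>K\<close>.\<close>
    have "resolvent K - resolvent 0 - (K - transpose K)
        = (resolvent K - resolvent 0) ** (K - transpose K)"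
      using resolvent_diff[of K 0] by (subst matrix_diff_rdistrib) (simp add: resolvent_0)
    then have "norm (resolvent K - resolvent 0 - (K - transpose K))
        \<le> norm (resolvent K - resolvent 0) * norm (K - transpose K) * C"
      using C(2) by (simp only:)
    also have "\<dots> \<le> norm (resolvent K - resolvent 0) * (norm K * D) * C"
      by (intro mult_right_mono mult_left_mono D C norm_ge_zero)
    finally show ?thesis
      by (cases "K = 0") (simp_all add: divide_le_eq mult_ac)
  qed
  then have le: "\<forall>\<^sub>F K :: real^'n^'n in at 0.
      norm (norm (resolvent (0 + K) - resolvent 0 - (K - transpose K)) / norm K)
        \<le> norm (resolvent K - resolvent 0) * (D * C)"
    by (simp only: real_norm_def abs_divide abs_norm_cancel eventually_True)
  have lim: "((\<lambda>K :: real^'n^'n. norm (resolvent K - resolvent 0) * (D * C)) \<longlongrightarrow> 0) (at 0)"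
    using continuous_on_resolvent
    by (auto simp: continuous_on_def intro!: tendsto_mult_left_zero tendsto_norm_zero LIM_zero)
  show ?thesis
    unfolding has_derivative_at
    by (intro conjI bounded_linear_skew_part Lim_null_comparison[OF le lim])
qed

text \<open>Equal to \<open>(I + S) (I - S)\<^sup>-\<^sup>1\<close>; in this affine form, continuity
  and the derivative carry over directly from \<open>resolvent\<close>.\<close>

definition cayley :: "real^'n^'n \<Rightarrow> real^'n^'n" where
  "cayley K = 2 *\<^sub>R resolvent K - mat 1"

lemma cayley_0: "cayley 0 = mat 1"
  by (simp add: cayley_def resolvent_0 scaleR_2)

lemma orthogonal_matrix_cayley: "orthogonal_matrix (cayley K)"
proof -
  define S where "S = K - transpose K"
  let ?R = "resolvent K"
  have R: "(mat 1 - S) ** ?R = mat 1"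
    unfolding S_def by (rule resolvent_right)
  have "transpose (mat 1 - S) = mat 1 + S"
    by (simp add: S_def transpose_diff)
  then have tR: "transpose ?R ** (mat 1 + S) = mat 1"
    using arg_cong[OF R, of transpose] by (simp only: matrix_transpose_mul transpose_mat)
  have "cayley K = (2 *\<^sub>R mat 1 - (mat 1 - S)) ** ?R"
    unfolding cayley_def
    by (subst matrix_diff_rdistrib) (simp add: R flip: scalar_matrix_assoc)
  then have c: "cayley K = (mat 1 + S) ** ?R"
    by (simp add: scaleR_2)
  have "transpose (cayley K) = 2 *\<^sub>R transpose ?R - mat 1"
    by (simp add: cayley_def transpose_diff transpose_scalar)
  also have "\<dots> = transpose ?R ** (2 *\<^sub>R mat 1 - (mat 1 + S))"
    by (simp only: matrix_diff_ldistrib tR) (simp add: matrix_scalar_ac)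
  also have "2 *\<^sub>R mat 1 - (mat 1 + S) = mat 1 - S"
    by (simp add: scaleR_2)
  finally have "transpose (cayley K) ** cayley K
      = transpose ?R ** ((mat 1 - S) ** (mat 1 + S)) ** ?R"
    by (simp add: c matrix_mul_assoc)
  \<comment> \<open>Commuting these two factors puts each next to its own inverse.\<close>
  also have "(mat 1 - S) ** (mat 1 + S) = (mat 1 + S) ** (mat 1 - S)"
    by (simp add: matrix_add_ldistrib matrix_add_rdistrib matrix_diff_rdistrib matrix_diff_ldistrib)
  also have "transpose ?R ** ((mat 1 + S) ** (mat 1 - S)) ** ?R
      = (transpose ?R ** (mat 1 + S)) ** ((mat 1 - S) ** ?R)"
    by (simp only: matrix_mul_assoc)
  also have "\<dots> = mat 1"
    by (simp only: tR R matrix_mul_lid)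
  finally show ?thesis
    by (simp add: orthogonal_matrix)
qed

lemma continuous_on_cayley: "continuous_on UNIV cayley"
  unfolding cayley_def by (intro continuous_intros continuous_on_resolvent)

lemma has_derivative_cayley_0:
  "((cayley :: real^'n^'n \<Rightarrow> _) has_derivative (\<lambda>K. 2 *\<^sub>R (K - transpose K))) (at 0)"
  unfolding cayley_def
  by (auto intro!: derivative_eq_intros has_derivative_resolvent_0)

section \<open>Surjectivity of the derivative\<close>

lemma inner_matrix_mult_left:
  fixes A :: "real^'n^'k" and K :: "real^'k^'m"
  shows "(K ** A) \<bullet> Y = K \<bullet> (Y ** transpose A)"
proof -
  have "(K ** A) \<bullet> Y = (\<Sum>i\<in>UNIV. \<Sum>j\<in>UNIV. \<Sum>k\<in>UNIV. K $ i $ k * A $ k $ j * Y $ i $ j)"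
    by (simp add: inner_vec_def matrix_matrix_mult_def sum_distrib_right)
  also have "\<dots> = (\<Sum>i\<in>UNIV. \<Sum>k\<in>UNIV. \<Sum>j\<in>UNIV. K $ i $ k * A $ k $ j * Y $ i $ j)"
    by (intro sum.cong refl sum.swap)
  also have "\<dots> = K \<bullet> (Y ** transpose A)"
    by (simp add: inner_vec_def matrix_matrix_mult_def transpose_def sum_distrib_left mult_ac)
  finally show ?thesis .
qed

lemma inner_transpose:
  fixes A B :: "real^'n^'m"
  shows "transpose A \<bullet> transpose B = A \<bullet> B"
  unfolding inner_vec_def transpose_def by simp (rule sum.swap)

lemma inner_matrix_mult_right:
  fixes A :: "real^'k^'m" and L :: "real^'n^'k"
  shows "(A ** L) \<bullet> Y = L \<bullet> (transpose A ** Y)"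
proof -
  have "(A ** L) \<bullet> Y = (transpose L ** transpose A) \<bullet> transpose Y"
    by (simp only: inner_transpose flip: matrix_transpose_mul)
  also have "\<dots> = transpose L \<bullet> transpose (transpose A ** Y)"
    by (simp only: inner_matrix_mult_left matrix_transpose_mul)
  finally show ?thesis
    by (simp only: inner_transpose)
qed

lemma inner_schur_product: "schur_product A X \<bullet> Y = X \<bullet> schur_product A Y"
  by (simp add: inner_vec_def schur_product_def mult_ac)

text \<open>Moving the transpose across the inner product turns the assumption into
  \<open>K \<bullet> (M - M\<^sup>T) = 0\<close>; then take
  \<open>K = M - M\<^sup>T\<close>.\<close>

lemma symmetric_matrix_if_orthogonal_skew:
  fixes M :: "real^'n^'n"
  assumes "\<And>K. (K - transpose K) \<bullet> M = 0"
  shows "symmetric_matrix M"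
proof -
  have "K \<bullet> (M - transpose M) = 0" for K
    using assms[of K] inner_transpose[of K "transpose M"]
    by (simp add: inner_diff_left inner_diff_right)
  from this[of "M - transpose M"] show ?thesis
    by (simp add: symmetric_matrix_def)
qed

section \<open>The perturbation map and its derivative at the origin\<close>

text \<open>This is the derivative of \<open>orbit_map\<close> at 0; the factors 2 come from the
  Cayley transform.\<close>

definition tangent_map ::
  "real^'n^'m \<Rightarrow> (real^'m^'m) \<times> (real^'n^'n) \<times> (real^'n^'m) \<Rightarrow> real^'n^'m" where
  "tangent_map A = (\<lambda>(K, L, C). (2 *\<^sub>R (K - transpose K)) ** A
     + A ** (2 *\<^sub>R (L - transpose L)) + schur_product A C)"

lemma bounded_linear_schur_product: "bounded_linear (schur_product A)"
  unfolding linear_conv_bounded_linear[symmetric]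
  by (rule linearI) (simp_all add: vec_eq_iff schur_product_def algebra_simps)

definition orbit_map ::
  "real^'n^'m \<Rightarrow> (real^'m^'m) \<times> (real^'n^'n) \<times> (real^'n^'m) \<Rightarrow> real^'n^'m" where
  "orbit_map A = (\<lambda>(K, L, C). cayley K ** A ** cayley L + schur_product A C)"

lemma has_derivative_orbit_map_0:
  fixes A :: "real^'n^'m"
  shows "(orbit_map A has_derivative tangent_map A) (at 0)"
proof -
  let ?fst = "fst :: (real^'m^'m) \<times> (real^'n^'n) \<times> (real^'n^'m) \<Rightarrow> _"
  let ?snd = "snd :: (real^'m^'m) \<times> (real^'n^'n) \<times> (real^'n^'m) \<Rightarrow> _"
  have dU: "((\<lambda>z. cayley (?fst z)) has_derivative
      (\<lambda>h. 2 *\<^sub>R (fst h - transpose (fst h)))) (at 0)"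
    by (rule has_derivative_compose[OF has_derivative_fst[OF has_derivative_ident]])
       (simp add: has_derivative_cayley_0)
  have dV: "((\<lambda>z. cayley (fst (?snd z))) has_derivative
      (\<lambda>h. 2 *\<^sub>R (fst (snd h) - transpose (fst (snd h))))) (at 0)"
    by (rule has_derivative_compose
          [OF has_derivative_fst[OF has_derivative_snd[OF has_derivative_ident]]])
       (simp add: has_derivative_cayley_0)
  have dC: "((\<lambda>z. schur_product A (snd (?snd z))) has_derivative
      (\<lambda>h. schur_product A (snd (snd h)))) (at 0)"
    by (intro bounded_linear.has_derivative[OF bounded_linear_schur_product] derivative_intros)
  note prod = bounded_bilinear.FDERIV[OF bounded_bilinear_matrix_matrix_mult]
  show ?thesis
    unfolding orbit_map_def case_prod_unfold
    by (rule has_derivative_eq_rhs[OF has_derivative_add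
          [OF prod[OF prod[OF dU has_derivative_const] dV] dC]])
       (auto simp: fun_eq_iff tangent_map_def cayley_0)
qed

lemma linear_tangent_map: "linear (tangent_map A)"
  using has_derivative_bounded_linear[OF has_derivative_orbit_map_0] bounded_linear.linear by blast

text \<open>A linear map is onto when its adjoint has trivial kernel. Testing a kernel element
  \<open>X\<close> against one of the three parameters at a time gives the three conditions of the
  SSVP.\<close>

lemma surj_tangent_map:
  assumes "SSVP A"
  shows "surj (tangent_map A)"
proof -
  have "X = 0" if "adjoint (tangent_map A) X = 0" for X
  proof -
    have *: "tangent_map A (K, L, C) \<bullet> X = 0" for K L C
      using adjoint_works[OF linear_tangent_map[of A], of "(K, L, C)" X] that by (simp add: inner_commute)
    have z: "schur_product A 0 = 0"
      by (simp add: linear_0 bounded_linear.linear[OF bounded_linear_schur_product])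
    have "symmetric_matrix (X ** transpose A)"
      using *[of _ 0 0]
      by (intro symmetric_matrix_if_orthogonal_skew)
         (simp add: tangent_map_def transpose_zero z inner_matrix_mult_left)
    moreover have "symmetric_matrix (transpose A ** X)"
      using *[of 0 _ 0]
      by (intro symmetric_matrix_if_orthogonal_skew)
         (simp add: tangent_map_def transpose_zero z inner_matrix_mult_right)
    \<comment> \<open>With \<open>C = A \<circ> X\<close> the inner product is the squared norm of
      \<open>A \<circ> X\<close>.\<close>
    moreover have "schur_product A X = 0"
      using *[of 0 0 "schur_product A X"] inner_schur_product[of A "schur_product A X" X]
      by (simp add: tangent_map_def transpose_zero)
    ultimately show ?thesis
      using assms by (auto simp: SSVP_def)
  qed
  then have "inj (adjoint (tangent_map A))"
    by (simp add: linear_injective_0 adjoint_linear linear_tangent_map)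
  then show ?thesis
    by (simp add: linear_tangent_map)
qed

section \<open>Realizing the pattern\<close>

theorem theorem4p1:
  fixes A P :: "real^'n^'m"
  assumes "SSVP A"
    and "superpattern P (pattern_of A)"
  shows "\<exists>B :: real^'n^'m. pattern_of B = P \<and> singular_values B = singular_values A"
proof -
  let ?U = "\<lambda>z :: (real^'m^'m) \<times> (real^'n^'n) \<times> (real^'n^'m). cayley (fst z) ** A ** cayley (fst (snd z))"
  let ?H = "\<lambda>z. ?U z + schur_product A (snd (snd z))"
  \<comment> \<open>An open neighbourhood of 0 on which no nonzero entry of \<open>A\<close> is lost
    in \<open>U A V\<close>.\<close>
  define T where "T = {z. \<forall>i j. A $ i $ j \<noteq> 0 \<longrightarrow> ?U z $ i $ j \<noteq> 0}"
  have H: "?H = orbit_map A"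
    by (simp add: orbit_map_def case_prod_unfold)
  have contU: "continuous_on UNIV ?U"
    by (intro bounded_bilinear.continuous_on[OF bounded_bilinear_matrix_matrix_mult]
        continuous_on_compose2[OF continuous_on_cayley] continuous_intros) auto
  have contH: "continuous_on UNIV ?H"
    by (intro contU continuous_intros bounded_linear.continuous_on[OF bounded_linear_schur_product])
  have "open T"
  proof -
    have "T = (\<Inter>i. \<Inter>j. {z. A $ i $ j \<noteq> 0 \<longrightarrow> ?U z $ i $ j \<noteq> 0})"
      by (auto simp: T_def)
    moreover have "open {z. A $ i $ j \<noteq> 0 \<longrightarrow> ?U z $ i $ j \<noteq> 0}" for i j
    proof (cases "A $ i $ j = 0")
      case False
      have "open {z. ?U z $ i $ j \<noteq> 0}"
        by (intro open_Collect_neq continuous_on_component contU continuous_on_const)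
      then show ?thesis using False by simp
    qed simp
    ultimately show ?thesis
      by (simp add: open_INT)
  qed
  have H0: "?H 0 = A"
    by (simp add: cayley_0 linear_0 bounded_linear.linear[OF bounded_linear_schur_product])
  have "0 \<in> T"
    by (simp add: T_def cayley_0)
  obtain g where g: "linear g" "tangent_map A \<circ> g = id"
    using linear_surjective_right_inverse[OF linear_tangent_map surj_tangent_map[OF assms(1)]] by auto
  \<comment> \<open>The open mapping theorem used here takes continuity, the derivative at the
    single point 0 and a linear right inverse \<open>g\<close> of it.\<close>
  have "?H 0 \<in> interior (?H ` T)"
    by (rule sussmann_open_mapping[OF open_UNIV contH UNIV_I has_derivative_orbit_map_0[of A, folded H] _ g(2) subset_UNIV])
       (use g(1) \<open>open T\<close> \<open>0 \<in> T\<close> in \<open>auto simp: linear_conv_bounded_linear interior_open\<close>)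
  then obtain e where "e > 0" and e: "ball A e \<subseteq> ?H ` T"
    unfolding H0 by (meson mem_interior)
  \<comment> \<open>\<open>E\<close> marks the changed zeros. The \<open>+ 1\<close> in the
    denominator of \<open>c\<close> covers \<open>E = 0\<close>, when no zero is changed.\<close>
  define E :: "real^'n^'m" where "E = (\<chi> i j. if A $ i $ j = 0 then P $ i $ j else 0)"
  define c where "c = e / (2 * (norm E + 1))"
  have "c > 0"
    using \<open>e > 0\<close> by (simp add: c_def add_nonneg_pos)
  have "norm (c *\<^sub>R E) < e"
  proof -
    have "c * norm E < c * (2 * (norm E + 1))"
      using \<open>c > 0\<close> by (intro mult_strict_left_mono) (auto simp: add_nonneg_pos add_increasing)
    also have "\<dots> = e"
      by (simp add: c_def add_nonneg_eq_0_iff)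
    finally show ?thesis
      using \<open>c > 0\<close> by simp
  qed
  then have "A + c *\<^sub>R E \<in> ball A e"
    by (simp add: dist_norm)
  then obtain z where "z \<in> T" and z: "A + c *\<^sub>R E = ?H z"
    using e by auto
  have P: "P $ i $ j = 0 \<or> P $ i $ j = 1" for i j
    using assms(2) by (auto simp: superpattern_def is_pattern_def)
  \<comment> \<open>The witness is \<open>?U z\<close>, not \<open>?H z\<close>, since the
    orthogonal factors preserve the singular values. Where \<open>A\<close> vanishes, so does
    \<open>A \<circ> C\<close>, and the entry is \<open>c\<close> times that of \<open>P\<close>;
    elsewhere membership in \<open>T\<close> keeps it nonzero.\<close>
  have "pattern_of (?U z) $ i $ j = P $ i $ j" for i j
  proof (cases "A $ i $ j = 0")
    case True
    have "?U z $ i $ j = c * P $ i $ j"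
      using arg_cong[OF z, of "\<lambda>M. M $ i $ j"] True by (simp add: schur_product_def E_def)
    then show ?thesis
      using P[of i j] \<open>c > 0\<close> by (auto simp: pattern_of_def)
  next
    case False
    then show ?thesis
      using assms(2) \<open>z \<in> T\<close> by (auto simp: superpattern_def pattern_of_def T_def)
  qed
  then have "pattern_of (?U z) = P"
    by (simp add: vec_eq_iff)
  moreover have "singular_values (?U z) = singular_values A"
    by (simp add: singular_values_orthogonal orthogonal_matrix_cayley)
  ultimately show ?thesis
    by blast
qed

end
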